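(* For all positive modal formulas $\phi$ and $\psi$, the sequent $\phi\vdash\psi$ is provable in $\mathsf{GL}_{+}^{\top\bot}$ if and only if $\mathcal{D}_{\mathsf{GLD}}\models\phi\vdash\psi$, where $\mathcal{D}_{\mathsf{GLD}}$ is the class of all GLD-lattices.
   Context: Positive modal formulas are built from a countable set $\mathsf{Prop}$ of propositional variables and the constants $\bot,\top$ using binary $\lor,\land$ and unary $\Diamond,\Box$; $\Phi$ is the set of all of them. $\Box^0\phi=\phi$, $\Box^{n+1}\phi=\Box(\Box^n\phi)$, and similarly for $\Diamond^n$. A sequent is an expression $\phi\vdash\psi$ with $\phi,\psi\in\Phi$. The proof system $\mathsf{GL}_{+}^{\top\bot}$ derives sequents (derivations may be infinite, well-founded trees because of the last two rules) from the following axioms and rules, for all $\phi,\psi,\chi\in\Phi$. Axioms: $\phi\vdash\phi$; $\phi\vdash\phi\lor\psi$; $\psi\vdash\phi\lor\psi$; $\phi\land\psi\vdash\phi$; $\phi\land\psi\vdash\psi$; $\phi\land(\psi\lor\chi)\vdash(\phi\land\psi)\lor(\phi\land\chi)$; $\Diamond(\phi\lor\psi)\vdash\Diamond\phi\lor\Diamond\psi$; $\Box\phi\land\Box\psi\vdash\Box(\phi\land\psi)$; $\Diamond\phi\land\Box\psi\vdash\Diamond(\phi\land\psi)$; $\Box(\phi\lor\psi)\vdash\Box\phi\lor\Diamond\psi$; $\bot\vdash\phi$; $\phi\vdash\top$; $\Diamond\bot\vdash\bot$; $\top\vdash\Box\top$; $\Diamond\Diamond\phi\vdash\Diamond\phi$;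 $\Box\phi\vdash\Box\Box\phi$. Rules: from $\phi\vdash\psi$ and $\psi\vdash\chi$ infer $\phi\vdash\chi$; from $\phi\vdash\chi$ and $\psi\vdash\chi$ infer $\phi\lor\psi\vdash\chi$; from $\chi\vdash\phi$ and $\chi\vdash\psi$ infer $\chi\vdash\phi\land\psi$; from $\phi\vdash\psi$ infer $\Diamond\phi\vdash\Diamond\psi$; from $\phi\vdash\psi$ infer $\Box\phi\vdash\Box\psi$; GLD-rules: from the premises $\psi\land\Box^n\bot\vdash\phi$ for all $n\in\omega$ infer $\psi\vdash\phi$; from the premises $\phi\vdash\psi\lor\Diamond^n\top$ for all $n\in\omega$ infer $\phi\vdash\psi$. A modal distributive lattice is an algebra $\langle A;\sqcup,\sqcap,\Diamond,\Box,0,1\rangle$ such that $\langle A;\sqcup,\sqcap,0,1\rangle$ is a bounded distributive lattice (with order $\leq$) and $\Box,\Diamond$ are unary operators on $A$ with $\Box 1=1$, $\Diamond 0=0$, and, for all $x,y\in A$, $\Box(x\sqcup y)\leq\Box x\sqcup\Diamond y$ and $\Box x\sqcap\Diamond y\leq\Diamond(x\sqcap y)$. A GLD-lattice is a modal distributive lattice $A$ such that: (1) $\Diamond 0=0$ and $\Box 1=1$; (2) $\Diamond(x\sqcup y)=\Diamond x\sqcup\Diamond y$ and $\Box(x\sqcap y)=\Box x\sqcap\Box y$ for all $x,y\in A$; (3) $\Diamond\Diamond x\leq\Diamond x$ and $\Box x\leq\Box\Box x$ for all $x\in A$; (4) for every $x\in A$, $\bigsqcup_{n\in\omega}(x\sqcap\Box^n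 0)=x$ and $\inf_{n\in\omega}(x\sqcup\Diamond^n 1)=x$ (i.e. $x$ is the least upper bound, respectively the greatest lower bound, of the indicated set in $A$). Here $\Box^n,\Diamond^n$ denote $n$-fold iteration, with the $0$-fold iterate the identity. A function $v:\mathsf{Prop}\to A$ is extended to all positive modal formulas by $v(\bot)=0$, $v(\top)=1$, $v(\phi\lor\psi)=v(\phi)\sqcup v(\psi)$, $v(\phi\land\psi)=v(\phi)\sqcap v(\psi)$, $v(\Diamond\phi)=\Diamond v(\phi)$, $v(\Box\phi)=\Box v(\phi)$. $A\models\phi\vdash\psi$ means $v(\phi)\leq v(\psi)$ for every $v:\mathsf{Prop}\to A$; for a class $C$ of modal distributive lattices, $C\models\phi\vdash\psi$ means $A\models\phi\vdash\psi$ for every $A\in C$. *)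

theory Defs
  imports "HOL-Algebra.Lattice" "HOL-Library.Countable"
begin

text \<open>The set of propositional variables is an arbitrary type; the theorem asks it to be of class
  \<^class>\<open>countable\<close>.\<close>

datatype 'p fm =
    Var 'p
  | Fls  (\<open>\<^bold>\<bottom>\<close>)
  | Tru  (\<open>\<^bold>\<top>\<close>)
  | Or "'p fm" "'p fm"  (infixr \<open>\<^bold>\<or>\<close> 65)
  | And "'p fm" "'p fm"  (infixr \<open>\<^bold>\<and>\<close> 70)
  | Dia "'p fm"  (\<open>\<^bold>\<diamond> _\<close> [80] 80)
  | Box "'p fm"  (\<open>\<^bold>\<box> _\<close> [80] 80)

text \<open>The two GLD-rules have infinitely many premises, so derivations are possibly infinite
  well-founded trees; this is exactly what an inductive predicate provides.\<close>

inductive GL_plus :: "'p fm \<Rightarrow> 'p fm \<Rightarrow> bool"  (infix \<open>\<turnstile>\<close> 50) where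
  ax_id:        "\<phi> \<turnstile> \<phi>"
| ax_orI1:      "\<phi> \<turnstile> \<phi> \<^bold>\<or> \<psi>"
| ax_orI2:      "\<psi> \<turnstile> \<phi> \<^bold>\<or> \<psi>"
| ax_andE1:     "\<phi> \<^bold>\<and> \<psi> \<turnstile> \<phi>"
| ax_andE2:     "\<phi> \<^bold>\<and> \<psi> \<turnstile> \<psi>"
| ax_distrib:   "\<phi> \<^bold>\<and> (\<psi> \<^bold>\<or> \<chi>) \<turnstile> (\<phi> \<^bold>\<and> \<psi>) \<^bold>\<or> (\<phi> \<^bold>\<and> \<chi>)"
| ax_dia_or:    "\<^bold>\<diamond> (\<phi> \<^bold>\<or> \<psi>) \<turnstile> \<^bold>\<diamond> \<phi> \<^bold>\<or> \<^bold>\<diamond> \<psi>"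
| ax_box_and:   "\<^bold>\<box> \<phi> \<^bold>\<and> \<^bold>\<box> \<psi> \<turnstile> \<^bold>\<box> (\<phi> \<^bold>\<and> \<psi>)"
| ax_dia_box:   "\<^bold>\<diamond> \<phi> \<^bold>\<and> \<^bold>\<box> \<psi> \<turnstile> \<^bold>\<diamond> (\<phi> \<^bold>\<and> \<psi>)"
| ax_box_dia:   "\<^bold>\<box> (\<phi> \<^bold>\<or> \<psi>) \<turnstile> \<^bold>\<box> \<phi> \<^bold>\<or> \<^bold>\<diamond> \<psi>"
| ax_bot:       "\<^bold>\<bottom> \<turnstile> \<phi>"
| ax_top:       "\<phi> \<turnstile> \<^bold>\<top>"
| ax_dia_bot:   "\<^bold>\<diamond> \<^bold>\<bottom> \<turnstile> \<^bold>\<bottom>"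
| ax_box_top:   "\<^bold>\<top> \<turnstile> \<^bold>\<box> \<^bold>\<top>"
| ax_dia_trans: "\<^bold>\<diamond> \<^bold>\<diamond> \<phi> \<turnstile> \<^bold>\<diamond> \<phi>"
| ax_box_trans: "\<^bold>\<box> \<phi> \<turnstile> \<^bold>\<box> \<^bold>\<box> \<phi>"
| r_cut:        "\<phi> \<turnstile> \<psi> \<Longrightarrow> \<psi> \<turnstile> \<chi> \<Longrightarrow> \<phi> \<turnstile> \<chi>"
| r_or:         "\<phi> \<turnstile> \<chi> \<Longrightarrow> \<psi> \<turnstile> \<chi> \<Longrightarrow> \<phi> \<^bold>\<or> \<psi> \<turnstile> \<chi>"
| r_and:        "\<chi> \<turnstile> \<phi> \<Longrightarrow> \<chi> \<turnstile> \<psi> \<Longrightarrow> \<chi> \<turnstile> \<phi> \<^bold>\<and> \<psi>"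
| r_dia:        "\<phi> \<turnstile> \<psi> \<Longrightarrow> \<^bold>\<diamond> \<phi> \<turnstile> \<^bold>\<diamond> \<psi>"
| r_box:        "\<phi> \<turnstile> \<psi> \<Longrightarrow> \<^bold>\<box> \<phi> \<turnstile> \<^bold>\<box> \<psi>"
| r_GLD_box:    "(\<And>n. \<psi> \<^bold>\<and> (Box ^^ n) \<^bold>\<bottom> \<turnstile> \<phi>) \<Longrightarrow> \<psi> \<turnstile> \<phi>"
| r_GLD_dia:    "(\<And>n. \<phi> \<turnstile> \<psi> \<^bold>\<or> (Dia ^^ n) \<^bold>\<top>) \<Longrightarrow> \<phi> \<turnstile> \<psi>"

text \<open>Lattices have an explicit carrier, and \<open>\<squnion>\<close>, \<open>\<sqinter>\<close>, \<open>\<bottom>\<close>, \<open>\<top>\<close> are the operations and constants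
  that HOL-Algebra derives from the order.  The locale \<^locale>\<open>bounded_lattice\<close> forces the record
  component \<open>eq\<close> to be equality.\<close>

record 'a modal_algebra = "'a gorder" +
  dia :: "'a \<Rightarrow> 'a"  (\<open>\<diamond>\<index> _\<close> [80] 80)
  box :: "'a \<Rightarrow> 'a"  (\<open>\<box>\<index> _\<close> [80] 80)

locale modal_distributive_lattice = bounded_lattice A
  for A :: "('a, 'm) modal_algebra_scheme" (structure) +
  assumes distrib: "\<lbrakk>x \<in> carrier A; y \<in> carrier A; z \<in> carrier A\<rbrakk>
      \<Longrightarrow> x \<sqinter> (y \<squnion> z) = (x \<sqinter> y) \<squnion> (x \<sqinter> z)"
    and dia_closed: "x \<in> carrier A \<Longrightarrow> \<diamond> x \<in> carrier A"
    and box_closed: "x \<in> carrier A \<Longrightarrow> \<box> x \<in> carrier A"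
    and box_top: "\<box> \<top> = \<top>"
    and dia_bottom: "\<diamond> \<bottom> = \<bottom>"
    and box_join_le: "\<lbrakk>x \<in> carrier A; y \<in> carrier A\<rbrakk> \<Longrightarrow> \<box> (x \<squnion> y) \<sqsubseteq> \<box> x \<squnion> \<diamond> y"
    and box_meet_dia_le: "\<lbrakk>x \<in> carrier A; y \<in> carrier A\<rbrakk> \<Longrightarrow> \<box> x \<sqinter> \<diamond> y \<sqsubseteq> \<diamond> (x \<sqinter> y)"

text \<open>The conditions \<open>\<diamond> \<bottom> = \<bottom>\<close> and \<open>\<box> \<top> = \<top>\<close> on a GLD-lattice are inherited.\<close>

locale GLD_lattice = modal_distributive_lattice +
  assumes dia_join: "\<lbrakk>x \<in> carrier A; y \<in> carrier A\<rbrakk> \<Longrightarrow> \<diamond> (x \<squnion> y) = \<diamond> x \<squnion> \<diamond> y"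
    and box_meet: "\<lbrakk>x \<in> carrier A; y \<in> carrier A\<rbrakk> \<Longrightarrow> \<box> (x \<sqinter> y) = \<box> x \<sqinter> \<box> y"
    and dia_dia_le: "x \<in> carrier A \<Longrightarrow> \<diamond> \<diamond> x \<sqsubseteq> \<diamond> x"
    and box_le_box_box: "x \<in> carrier A \<Longrightarrow> \<box> x \<sqsubseteq> \<box> \<box> x"
    and lub_meet_box_pow: "x \<in> carrier A \<Longrightarrow> is_lub A x (range (\<lambda>n. x \<sqinter> (box A ^^ n) \<bottom>))"
    and glb_join_dia_pow: "x \<in> carrier A \<Longrightarrow> is_glb A x (range (\<lambda>n. x \<squnion> (dia A ^^ n) \<top>))"

definition GLD_lattices :: "'a modal_algebra set" where
  "GLD_lattices = {A. GLD_lattice A}"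

primrec interp :: "'a modal_algebra \<Rightarrow> ('p \<Rightarrow> 'a) \<Rightarrow> 'p fm \<Rightarrow> 'a" where
  "interp A v (Var p) = v p"
| "interp A v \<^bold>\<bottom> = \<bottom>\<^bsub>A\<^esub>"
| "interp A v \<^bold>\<top> = \<top>\<^bsub>A\<^esub>"
| "interp A v (\<phi> \<^bold>\<or> \<psi>) = interp A v \<phi> \<squnion>\<^bsub>A\<^esub> interp A v \<psi>"
| "interp A v (\<phi> \<^bold>\<and> \<psi>) = interp A v \<phi> \<sqinter>\<^bsub>A\<^esub> interp A v \<psi>"
| "interp A v (\<^bold>\<diamond> \<phi>) = \<diamond>\<^bsub>A\<^esub> (interp A v \<phi>)"
| "interp A v (\<^bold>\<box> \<phi>) = \<box>\<^bsub>A\<^esub> (interp A v \<phi>)"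

definition valid_in :: "'a modal_algebra \<Rightarrow> 'p fm \<Rightarrow> 'p fm \<Rightarrow> bool" where
  "valid_in A \<phi> \<psi> \<longleftrightarrow> (\<forall>v. range v \<subseteq> carrier A \<longrightarrow> interp A v \<phi> \<sqsubseteq>\<^bsub>A\<^esub> interp A v \<psi>)"

definition class_valid :: "'a modal_algebra set \<Rightarrow> 'p fm \<Rightarrow> 'p fm \<Rightarrow> bool" where
  "class_valid C \<phi> \<psi> \<longleftrightarrow> (\<forall>A\<in>C. valid_in A \<phi> \<psi>)"

text \<open>A pitfall: \<^const>\<open>GLD_lattices\<close> at type \<open>'a\<close> contains the GLD-lattices whose carrier is a subset of
  \<open>'a\<close>, and HOL cannot quantify over all types inside a formula.  The class of all GLD-lattices is
  therefore rendered by a free type variable \<open>'a\<close>: soundness is claimed for every \<open>'a\<close>, and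
  completeness for every infinite \<open>'a\<close>.  Completeness from validity over a single infinite type
  implies completeness from validity over all types; over a finite type it can fail, since such a
  type carries only lattices of bounded size.\<close>

end

theory Submission
  imports Defs
begin

text \<open>Soundness is an induction on derivations: each rule of the calculus is a law of GLD-lattices, the
  two infinitary rules being the least-upper-bound and greatest-lower-bound conditions
  (\<open>le_of_meet_box_pow\<close>, \<open>le_of_join_dia_pow\<close>).

  For completeness, the Lindenbaum algebra, whose elements are the classes \<open>[\<psi>]\<close> of interderivable
  formulas, is a GLD-lattice in which the canonical valuation satisfies exactly the derivable
  sequents. The delicate point in such constructions is usually that quotients or completions need
  not preserve infinite meets and joins. Here a GLD-lattice may be incomplete, so the only infinite
  joins that matter are those stating that \<open>[\<psi>]\<close> is the least upper bound of the classes
  \<open>[\<psi> \<^bold>\<and> \<^bold>\<box>\<^sup>n\<^bold>\<bottom>]\<close>. Every competing upper bound is itself the class of a formula, so this is literally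
  the first infinitary rule (\<open>is_lub_and_box_pow\<close>); the second rule is the dual statement
  (\<open>is_glb_or_dia_pow\<close>).

  The carrier of a test lattice has to be a subset of the given infinite type. Since there are only
  countably many formulas, some map \<open>e\<close> from formulas into that type identifies exactly the
  interderivable ones (\<open>ex_lindenbaum_coding\<close>). The Lindenbaum algebra is built on the range of \<open>e\<close>,
  the element \<open>e \<phi>\<close> standing for the class \<open>[\<phi>]\<close>.\<close>

section \<open>Soundness\<close>

context GLD_lattice
begin

text \<open>Monotonicity validates the rules \<open>r_dia\<close> and \<open>r_box\<close>; as in any lattice, preserving binary joins
  (or meets) is enough for it.\<close>

lemma dia_mono:
  assumes "x \<in> carrier A" "y \<in> carrier A" "x \<sqsubseteq> y"
  shows "\<diamond> x \<sqsubseteq> \<diamond> y"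
proof -
  have "x \<squnion> y = y"
    using assms le_iff_meet by metis
  then have "\<diamond> x \<squnion> \<diamond> y = \<diamond> y"
    using dia_join assms by metis
  then show ?thesis
    using join_left[of "\<diamond> x" "\<diamond> y"] assms dia_closed by metis
qed

lemma box_mono:
  assumes "x \<in> carrier A" "y \<in> carrier A" "x \<sqsubseteq> y"
  shows "\<box> x \<sqsubseteq> \<box> y"
proof -
  have "x \<sqinter> y = x"
    using assms le_iff_join by metis
  then have "\<box> x \<sqinter> \<box> y = \<box> x"
    using box_meet assms by metis
  then show ?thesis
    using meet_right[of "\<box> x" "\<box> y"] assms box_closed by metis
qed

text \<open>The two infinitary rules, read inside a GLD-lattice.\<close>

lemma le_of_meet_box_pow:
  assumes "x \<in> carrier A" "y \<in> carrier A" "\<And>n. x \<sqinter> (box A ^^ n) \<bottom> \<sqsubseteq> y"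
  shows "x \<sqsubseteq> y"
  by (rule least_le[OF lub_meet_box_pow[OF assms(1)]]) (use assms in \<open>auto simp: Upper_def\<close>)

lemma le_of_join_dia_pow:
  assumes "x \<in> carrier A" "y \<in> carrier A" "\<And>n. x \<sqsubseteq> y \<squnion> (dia A ^^ n) \<top>"
  shows "x \<sqsubseteq> y"
  by (rule greatest_le[OF glb_join_dia_pow[OF assms(2)]]) (use assms in \<open>auto simp: Lower_def\<close>)

end

lemma interp_box_pow: "interp A v ((Box ^^ n) \<phi>) = (box A ^^ n) (interp A v \<phi>)"
  by (induction n) auto

lemma interp_dia_pow: "interp A v ((Dia ^^ n) \<phi>) = (dia A ^^ n) (interp A v \<phi>)"
  by (induction n) auto

lemma interp_closed:
  assumes "GLD_lattice A" "range v \<subseteq> carrier A"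
  shows "interp A v \<phi> \<in> carrier A"
proof -
  interpret GLD_lattice A by fact
  show ?thesis
    using assms(2) by (induction \<phi>) (auto intro: dia_closed box_closed)
qed

lemma soundness:
  assumes "\<phi> \<turnstile> \<psi>" "GLD_lattice A" "range v \<subseteq> carrier A"
  shows "interp A v \<phi> \<sqsubseteq>\<^bsub>A\<^esub> interp A v \<psi>"
proof -
  interpret GLD_lattice A by fact
  note closed [simp] = interp_closed[OF assms(2,3)] dia_closed box_closed
  from assms(1) show ?thesis
  proof (induction rule: GL_plus.induct)
    case (r_cut \<phi> \<psi> \<chi>)
    then show ?case by (meson le_trans closed(1))
  next
    case (r_or \<phi> \<chi> \<psi>)
    then show ?case by (simp add: join_le)
  next
    case (r_and \<chi> \<phi> \<psi>)
    then show ?case by (simp add: meet_le)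
  next
    case (ax_dia_box \<phi> \<psi>)
    show ?case
      using box_meet_dia_le[of "interp A v \<psi>" "interp A v \<phi>"] by (simp add: meet_comm)
  next
    case (r_GLD_box \<psi> \<phi>)
    show ?case
      by (rule le_of_meet_box_pow) (use r_GLD_box.IH in \<open>simp_all add: interp_box_pow\<close>)
  next
    case (r_GLD_dia \<phi> \<psi>)
    show ?case
      by (rule le_of_join_dia_pow) (use r_GLD_dia.IH in \<open>simp_all add: interp_dia_pow\<close>)
  qed (simp_all add: join_left join_right meet_left meet_right distrib dia_join box_meet
      box_join_le dia_bottom box_top dia_dia_le box_le_box_box dia_mono box_mono
      bottom_lower top_higher)
qed

section \<open>The Lindenbaum algebra\<close>

instance fm :: (countable) countable
  by countable_datatype

text \<open>Choose a representative \<open>rep \<phi>\<close> of each class, number the formulas, and send the numbers injectively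
  into the infinite type. Choosing representatives first makes the numbering constant on classes.\<close>

lemma ex_lindenbaum_coding:
  assumes "infinite (UNIV :: 'a set)"
  shows "\<exists>e :: 'p::countable fm \<Rightarrow> 'a. \<forall>\<phi> \<psi>. e \<phi> = e \<psi> \<longleftrightarrow> \<phi> \<turnstile> \<psi> \<and> \<psi> \<turnstile> \<phi>"
proof -
  obtain h :: "nat \<Rightarrow> 'a" where h: "inj h"
    using infinite_countable_subset[OF assms] by blast
  define rep :: "'p fm \<Rightarrow> 'p fm" where "rep \<phi> = (SOME \<chi>. \<phi> \<turnstile> \<chi> \<and> \<chi> \<turnstile> \<phi>)" for \<phi>
  have rep: "\<phi> \<turnstile> rep \<phi> \<and> rep \<phi> \<turnstile> \<phi>" for \<phi>
    unfolding rep_def by (rule someI[of _ \<phi>]) (simp add: ax_id)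
  have rep_eq: "rep \<phi> = rep \<psi> \<longleftrightarrow> \<phi> \<turnstile> \<psi> \<and> \<psi> \<turnstile> \<phi>" for \<phi> \<psi>
  proof
    assume "rep \<phi> = rep \<psi>"
    then show "\<phi> \<turnstile> \<psi> \<and> \<psi> \<turnstile> \<phi>"
      using rep by (metis r_cut)
  next
    assume "\<phi> \<turnstile> \<psi> \<and> \<psi> \<turnstile> \<phi>"
    \<comment> \<open>\<open>rep\<close> depends only on the predicate from which it chooses, that is, on the class.\<close>
    then have "(\<lambda>\<chi>. \<phi> \<turnstile> \<chi> \<and> \<chi> \<turnstile> \<phi>) = (\<lambda>\<chi>. \<psi> \<turnstile> \<chi> \<and> \<chi> \<turnstile> \<psi>)"
      by (intro ext iffI conjI) (metis r_cut)+
    then show "rep \<phi> = rep \<psi>"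
      unfolding rep_def by simp
  qed
  have "h (to_nat (rep \<phi>)) = h (to_nat (rep \<psi>)) \<longleftrightarrow> \<phi> \<turnstile> \<psi> \<and> \<psi> \<turnstile> \<phi>" for \<phi> \<psi>
    using h rep_eq by (simp add: inj_eq)
  then show ?thesis
    by (intro exI[of _ "\<lambda>\<phi>. h (to_nat (rep \<phi>))"]) blast
qed

locale lindenbaum_coding =
  fixes e :: "'p fm \<Rightarrow> 'a"
  assumes e_eq_iff: "e \<phi> = e \<psi> \<longleftrightarrow> \<phi> \<turnstile> \<psi> \<and> \<psi> \<turnstile> \<phi>"
begin

text \<open>The inverse \<open>inv e\<close> picks an arbitrary formula of each class. Independence of this choice is
  \<open>le_L\<close>, \<open>dia_L\<close> and \<open>box_L\<close> below; for the modal operators it rests on the rules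
  \<open>r_dia\<close> and \<open>r_box\<close>.\<close>

definition L :: "'a modal_algebra" where
  "L = \<lparr>carrier = range e, eq = (=), le = (\<lambda>a b. inv e a \<turnstile> inv e b),
        dia = (\<lambda>a. e (\<^bold>\<diamond> inv e a)), box = (\<lambda>a. e (\<^bold>\<box> inv e a))\<rparr>"

lemma carrier_L [simp]: "carrier L = range e"
  by (simp add: L_def)

lemma inv_e: "inv e (e \<phi>) \<turnstile> \<phi>" "\<phi> \<turnstile> inv e (e \<phi>)"
  using e_eq_iff[of "inv e (e \<phi>)" \<phi>] by (simp_all add: f_inv_into_f)

lemma le_L [simp]: "e \<phi> \<sqsubseteq>\<^bsub>L\<^esub> e \<psi> \<longleftrightarrow> \<phi> \<turnstile> \<psi>"
proof
  assume "e \<phi> \<sqsubseteq>\<^bsub>L\<^esub> e \<psi>"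
  then have "inv e (e \<phi>) \<turnstile> inv e (e \<psi>)"
    by (simp add: L_def)
  then show "\<phi> \<turnstile> \<psi>"
    by (rule r_cut[OF inv_e(2) r_cut[OF _ inv_e(1)]])
next
  assume "\<phi> \<turnstile> \<psi>"
  then have "inv e (e \<phi>) \<turnstile> inv e (e \<psi>)"
    by (rule r_cut[OF inv_e(1) r_cut[OF _ inv_e(2)]])
  then show "e \<phi> \<sqsubseteq>\<^bsub>L\<^esub> e \<psi>"
    by (simp add: L_def)
qed

lemma dia_L [simp]: "\<diamond>\<^bsub>L\<^esub> (e \<phi>) = e (\<^bold>\<diamond> \<phi>)"
  unfolding L_def by (simp add: e_eq_iff inv_e r_dia)

lemma box_L [simp]: "\<box>\<^bsub>L\<^esub> (e \<phi>) = e (\<^bold>\<box> \<phi>)"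
  unfolding L_def by (simp add: e_eq_iff inv_e r_box)

lemma dia_pow_L: "(dia L ^^ n) (e \<phi>) = e ((Dia ^^ n) \<phi>)"
  by (induction n) auto

lemma box_pow_L: "(box L ^^ n) (e \<phi>) = e ((Box ^^ n) \<phi>)"
  by (induction n) auto

lemma eq_L [simp]: "(.=\<^bsub>L\<^esub>) = (=)"
  by (simp add: L_def)

lemma partial_order_L: "partial_order L"
proof
  fix x y z
  assume "x \<in> carrier L" "y \<in> carrier L" "z \<in> carrier L"
    and "x \<sqsubseteq>\<^bsub>L\<^esub> y" "y \<sqsubseteq>\<^bsub>L\<^esub> z"
  then show "x \<sqsubseteq>\<^bsub>L\<^esub> z"
    by (auto elim: r_cut)
qed (auto simp: e_eq_iff intro: ax_id)

lemma least_or: "least L (e (\<phi> \<^bold>\<or> \<psi>)) (Upper L {e \<phi>, e \<psi>})"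
  by (rule least_UpperI) (auto simp: Upper_def all_conj_distrib intro: ax_orI1 ax_orI2 r_or)

lemma greatest_and: "greatest L (e (\<phi> \<^bold>\<and> \<psi>)) (Lower L {e \<phi>, e \<psi>})"
  by (rule greatest_LowerI) (auto simp: Lower_def all_conj_distrib intro: ax_andE1 ax_andE2 r_and)

sublocale bounded_lattice L
proof -
  interpret partial_order L by (rule partial_order_L)
  show "bounded_lattice L"
  proof
    show "\<exists>s. least L s (Upper L {x, y})" if "x \<in> carrier L" "y \<in> carrier L" for x y
      using that least_or by auto
    show "\<exists>s. greatest L s (Lower L {x, y})" if "x \<in> carrier L" "y \<in> carrier L" for x y
      using that greatest_and by auto
    show "\<exists>x. least L x (carrier L)"
      by (rule exI[of _ "e \<^bold>\<bottom>"]) (auto simp: least_def intro: ax_bot)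
    show "\<exists>x. greatest L x (carrier L)"
      by (rule exI[of _ "e \<^bold>\<top>"]) (auto simp: greatest_def intro: ax_top)
  qed
qed

lemma join_L [simp]: "e \<phi> \<squnion>\<^bsub>L\<^esub> e \<psi> = e (\<phi> \<^bold>\<or> \<psi>)"
  by (rule joinI) (auto intro: least_unique least_or)

lemma meet_L [simp]: "e \<phi> \<sqinter>\<^bsub>L\<^esub> e \<psi> = e (\<phi> \<^bold>\<and> \<psi>)"
  by (rule meetI) (auto intro: greatest_unique greatest_and)

lemma bottom_L [simp]: "\<bottom>\<^bsub>L\<^esub> = e \<^bold>\<bottom>"
  by (rule bottom_eq[symmetric]) (auto intro: ax_bot)

lemma top_L [simp]: "\<top>\<^bsub>L\<^esub> = e \<^bold>\<top>"
  by (rule top_eq[symmetric]) (auto intro: ax_top)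

text \<open>An upper bound in the carrier has the form \<open>e \<phi>\<close>. To bound all \<open>e (\<psi> \<^bold>\<and> \<^bold>\<box>\<^sup>n\<^bold>\<bottom>)\<close> means that all
  premises of the infinitary rule with conclusion \<open>\<psi> \<turnstile> \<phi>\<close> are derivable.\<close>

lemma is_lub_and_box_pow: "is_lub L (e \<psi>) (range (\<lambda>n. e (\<psi> \<^bold>\<and> (Box ^^ n) \<^bold>\<bottom>)))"
proof (rule least_UpperI)
  fix y
  assume y: "y \<in> Upper L (range (\<lambda>n. e (\<psi> \<^bold>\<and> (Box ^^ n) \<^bold>\<bottom>)))"
  then obtain \<phi> where \<phi>: "y = e \<phi>"
    by (auto simp: Upper_def)
  have "e (\<psi> \<^bold>\<and> (Box ^^ n) \<^bold>\<bottom>) \<sqsubseteq>\<^bsub>L\<^esub> y" for n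
    by (rule Upper_memD[OF y, THEN conjunct1]) auto
  then show "e \<psi> \<sqsubseteq>\<^bsub>L\<^esub> y"
    by (auto simp: \<phi> intro: r_GLD_box)
next
  fix x
  assume "x \<in> range (\<lambda>n. e (\<psi> \<^bold>\<and> (Box ^^ n) \<^bold>\<bottom>))"
  then obtain n where "x = e (\<psi> \<^bold>\<and> (Box ^^ n) \<^bold>\<bottom>)"
    by (rule rangeE)
  then show "x \<sqsubseteq>\<^bsub>L\<^esub> e \<psi>"
    by (simp add: ax_andE1)
qed auto

lemma is_glb_or_dia_pow: "is_glb L (e \<psi>) (range (\<lambda>n. e (\<psi> \<^bold>\<or> (Dia ^^ n) \<^bold>\<top>)))"
proof (rule greatest_LowerI)
  fix y
  assume y: "y \<in> Lower L (range (\<lambda>n. e (\<psi> \<^bold>\<or> (Dia ^^ n) \<^bold>\<top>)))"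
  then obtain \<phi> where \<phi>: "y = e \<phi>"
    by (auto simp: Lower_def)
  have "y \<sqsubseteq>\<^bsub>L\<^esub> e (\<psi> \<^bold>\<or> (Dia ^^ n) \<^bold>\<top>)" for n
    by (rule Lower_memD[OF y, THEN conjunct1]) auto
  then show "y \<sqsubseteq>\<^bsub>L\<^esub> e \<psi>"
    by (auto simp: \<phi> intro: r_GLD_dia)
next
  fix x
  assume "x \<in> range (\<lambda>n. e (\<psi> \<^bold>\<or> (Dia ^^ n) \<^bold>\<top>))"
  then obtain n where "x = e (\<psi> \<^bold>\<or> (Dia ^^ n) \<^bold>\<top>)"
    by (rule rangeE)
  then show "e \<psi> \<sqsubseteq>\<^bsub>L\<^esub> x"
    by (simp add: ax_orI1)
qed auto

lemma and_mono: "\<phi> \<turnstile> \<phi>' \<Longrightarrow> \<psi> \<turnstile> \<psi>' \<Longrightarrow> \<phi> \<^bold>\<and> \<psi> \<turnstile> \<phi>' \<^bold>\<and> \<psi>'"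
  by (intro r_and r_cut[OF ax_andE1] r_cut[OF ax_andE2])

lemma and_comm: "\<phi> \<^bold>\<and> \<psi> \<turnstile> \<psi> \<^bold>\<and> \<phi>"
  by (blast intro: r_and ax_andE1 ax_andE2)

lemma GLD_lattice_L: "GLD_lattice L"
proof
  fix x y z
  assume "x \<in> carrier L" "y \<in> carrier L" "z \<in> carrier L"
  then obtain \<phi> \<psi> \<chi> where xyz: "x = e \<phi>" "y = e \<psi>" "z = e \<chi>"
    by auto
  have "\<phi> \<^bold>\<and> \<psi> \<^bold>\<or> \<phi> \<^bold>\<and> \<chi> \<turnstile> \<phi> \<^bold>\<and> (\<psi> \<^bold>\<or> \<chi>)"
    by (intro r_or and_mono ax_id ax_orI1 ax_orI2)
  then show "x \<sqinter>\<^bsub>L\<^esub> (y \<squnion>\<^bsub>L\<^esub> z) = (x \<sqinter>\<^bsub>L\<^esub> y) \<squnion>\<^bsub>L\<^esub> (x \<sqinter>\<^bsub>L\<^esub> z)"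
    by (simp add: xyz e_eq_iff ax_distrib)
next
  fix x y
  assume "x \<in> carrier L" "y \<in> carrier L"
  then obtain \<phi> \<psi> where xy: "x = e \<phi>" "y = e \<psi>"
    by auto
  show "\<box>\<^bsub>L\<^esub> (x \<squnion>\<^bsub>L\<^esub> y) \<sqsubseteq>\<^bsub>L\<^esub> \<box>\<^bsub>L\<^esub> x \<squnion>\<^bsub>L\<^esub> \<diamond>\<^bsub>L\<^esub> y"
    by (simp add: xy ax_box_dia)
  have "\<^bold>\<box> \<phi> \<^bold>\<and> \<^bold>\<diamond> \<psi> \<turnstile> \<^bold>\<diamond> (\<phi> \<^bold>\<and> \<psi>)"
    by (rule r_cut[OF and_comm r_cut[OF ax_dia_box r_dia[OF and_comm]]])
  then show "\<box>\<^bsub>L\<^esub> x \<sqinter>\<^bsub>L\<^esub> \<diamond>\<^bsub>L\<^esub> y \<sqsubseteq>\<^bsub>L\<^esub> \<diamond>\<^bsub>L\<^esub> (x \<sqinter>\<^bsub>L\<^esub> y)"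
    by (simp add: xy)
  have "\<^bold>\<diamond> \<phi> \<^bold>\<or> \<^bold>\<diamond> \<psi> \<turnstile> \<^bold>\<diamond> (\<phi> \<^bold>\<or> \<psi>)"
    by (intro r_or r_dia ax_orI1 ax_orI2)
  then show "\<diamond>\<^bsub>L\<^esub> (x \<squnion>\<^bsub>L\<^esub> y) = \<diamond>\<^bsub>L\<^esub> x \<squnion>\<^bsub>L\<^esub> \<diamond>\<^bsub>L\<^esub> y"
    by (simp add: xy e_eq_iff ax_dia_or)
  have "\<^bold>\<box> (\<phi> \<^bold>\<and> \<psi>) \<turnstile> \<^bold>\<box> \<phi> \<^bold>\<and> \<^bold>\<box> \<psi>"
    by (intro r_and r_box ax_andE1 ax_andE2)
  then show "\<box>\<^bsub>L\<^esub> (x \<sqinter>\<^bsub>L\<^esub> y) = \<box>\<^bsub>L\<^esub> x \<sqinter>\<^bsub>L\<^esub> \<box>\<^bsub>L\<^esub> y"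
    by (simp add: xy e_eq_iff ax_box_and)
next
  fix x
  assume "x \<in> carrier L"
  then obtain \<phi> where x: "x = e \<phi>"
    by auto
  show "\<diamond>\<^bsub>L\<^esub> x \<in> carrier L" "\<box>\<^bsub>L\<^esub> x \<in> carrier L"
    by (simp_all add: x)
  show "is_lub L x (range (\<lambda>n. x \<sqinter>\<^bsub>L\<^esub> (box L ^^ n) \<bottom>\<^bsub>L\<^esub>))"
    using is_lub_and_box_pow by (simp add: x box_pow_L)
  show "is_glb L x (range (\<lambda>n. x \<squnion>\<^bsub>L\<^esub> (dia L ^^ n) \<top>\<^bsub>L\<^esub>))"
    using is_glb_or_dia_pow by (simp add: x dia_pow_L)
qed (auto simp: e_eq_iff intro: ax_top ax_bot ax_dia_bot ax_box_top ax_dia_trans ax_box_trans)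

lemma interp_L: "interp L (\<lambda>p. e (Var p)) \<phi> = e \<phi>"
  by (induction \<phi>) simp_all

lemma derivable_if_valid_in_L:
  fixes \<phi> \<psi> :: "'p fm"
  assumes "valid_in L \<phi> \<psi>"
  shows "\<phi> \<turnstile> \<psi>"
proof -
  have "range (\<lambda>p. e (Var p)) \<subseteq> carrier L"
    by auto
  then have "interp L (\<lambda>p. e (Var p)) \<phi> \<sqsubseteq>\<^bsub>L\<^esub> interp L (\<lambda>p. e (Var p)) \<psi>"
    using assms unfolding valid_in_def by blast
  then show ?thesis
    by (simp add: interp_L)
qed

end

section \<open>Soundness and completeness\<close>

theorem theorem5p7:
  fixes \<phi> \<psi> :: "'p::countable fm"
  shows "(\<phi> \<turnstile> \<psi> \<longrightarrow> class_valid (GLD_lattices :: 'a modal_algebra set) \<phi> \<psi>) \<and>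
    (infinite (UNIV :: 'a set) \<longrightarrow>
      class_valid (GLD_lattices :: 'a modal_algebra set) \<phi> \<psi> \<longrightarrow> \<phi> \<turnstile> \<psi>)"
proof (intro conjI impI)
  assume "\<phi> \<turnstile> \<psi>"
  then show "class_valid (GLD_lattices :: 'a modal_algebra set) \<phi> \<psi>"
    by (auto simp: class_valid_def valid_in_def GLD_lattices_def intro: soundness)
next
  assume inf: "infinite (UNIV :: 'a set)"
    and valid: "class_valid (GLD_lattices :: 'a modal_algebra set) \<phi> \<psi>"
  obtain e :: "'p fm \<Rightarrow> 'a" where "\<And>\<phi> \<psi>. e \<phi> = e \<psi> \<longleftrightarrow> \<phi> \<turnstile> \<psi> \<and> \<psi> \<turnstile> \<phi>"
    using ex_lindenbaum_coding[OF inf] by blast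
  then interpret lindenbaum_coding e
    by unfold_locales
  show "\<phi> \<turnstile> \<psi>"
    using valid GLD_lattice_L
    by (intro derivable_if_valid_in_L) (simp add: class_valid_def GLD_lattices_def)
qed

end
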